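(* Let $(\mathscr{G},\{\circ_\lambda\}_{\lambda\in\Lambda})$ be a dynamical group, $(\mathscr{H},\{\cdot_\lambda\}_{\lambda\in\Lambda})$ a constant dynamical group, $\{\Phi_\lambda:G\to\mathrm{Bij}(H)\}_{\lambda\in\Lambda}$ an action of $\mathscr{G}$ on $\mathscr{H}$, and $\mathcal{B}:H\to G$ a relative Rota-Baxter operator on $\mathscr{G}$ with respect to this action. Define $\phi_{\mathcal{B}}:\Lambda\times H\to\Lambda$ and $\vartriangleright^{\mathcal{B}}_\lambda:H\times H\to H$ by $$\phi_{\mathcal{B}}(\lambda,x)=\phi_G(\lambda,\mathcal{B}(x)),\qquad x\vartriangleright^{\mathcal{B}}_\lambda y=\Phi_\lambda(\mathcal{B}(x))(y).$$ Then $(H,\Lambda,\phi_{\mathcal{B}},\{\cdot_\lambda\}_{\lambda\in\Lambda},\{\vartriangleright^{\mathcal{B}}_\lambda\}_{\lambda\in\Lambda})$ is a dynamical post-group, and its sub-adjacent dynamical group is the descendant dynamical group of $\mathcal{B}$.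
   Context: Fix a non-empty set $\Lambda$. A dynamical set is a triple $(X,\Lambda,\phi_X)$ with $X$ a set and $\phi_X:\Lambda\times X\to\Lambda$ a map. Dynamical group: a dynamical set $\mathscr{G}=(G,\Lambda,\phi_G)$ with maps $\circ_\lambda:G\times G\to G$ ($\lambda\in\Lambda$) such that $\phi_G(\lambda,a\circ_\lambda b)=\phi_G(\phi_G(\lambda,a),b)$ and $a\circ_\lambda(b\circ_{\phi_G(\lambda,a)}c)=(a\circ_\lambda b)\circ_\lambda c$; an element $e_G$ with $a\circ_\lambda e_G=e_G\circ_\lambda a=a$ and $\phi_G(\lambda,e_G)=\lambda$; and for all $\lambda,a$ an element $\bar a^\lambda$ with $a\circ_\lambda\bar a^\lambda=\bar a^\lambda\circ_{\phi_G(\lambda,a)}a=e_G$. A constant dynamical group is a dynamical group $(\mathscr{H},\cdot)$ with $\phi_H(\lambda,x)=\lambda$ (i.e. a family of group structures $\cdot_\lambda$ on $H$ with common unit $e_H$). Action of $\mathscr{G}$ on a constant dynamical group $\mathscr{H}$: maps $\Phi_\lambda:G\to\mathrm{Bij}(H)$ (bijections of the set $H$) with $\Phi_\lambda(a)(x\cdot_{\phi_G(\lambda,a)}y)=(\Phi_\lambda(a)x)\cdot_\lambda(\Phi_\lambda(a)y)$ and $\Phi_\lambda(a\circ_\lambda b)=\Phi_\lambda(a)\Phi_{\phi_G(\lambda,a)}(b)$. Relative Rota-Baxter operator: a map $\mathcal{B}:H\to G$ with $\mathcal{B}(x)\circ_\lambda\mathcal{B}(y)=\mathcal{B}(x\cdot_\lambda\Phi_\lambda(\mathcal{B}(x))(y))$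 for all $\lambda,x,y$. Its descendant dynamical group is the dynamical group $(H,\Lambda,\phi_{\mathcal{B}},\{\circ^{\mathcal{B}}_\lambda\})$ with $\phi_{\mathcal{B}}(\lambda,x)=\phi_G(\lambda,\mathcal{B}(x))$ and $x\circ^{\mathcal{B}}_\lambda y=x\cdot_\lambda\Phi_\lambda(\mathcal{B}(x))(y)$. Dynamical post-group: a dynamical set $(K,\Lambda,\phi_K)$ with maps $\cdot_\lambda,\vartriangleright_\lambda:K\times K\to K$ such that $(K,\Lambda,\{\cdot_\lambda\})$ is a constant dynamical group; $a\vartriangleright_\lambda(b\cdot_{\phi_K(\lambda,a)}c)=(a\vartriangleright_\lambda b)\cdot_\lambda(a\vartriangleright_\lambda c)$; $(a\cdot_\lambda(a\vartriangleright_\lambda b))\vartriangleright_\lambda c=a\vartriangleright_\lambda(b\vartriangleright_{\phi_K(\lambda,a)}c)$; and each map $b\mapsto a\vartriangleright_\lambda b$ is bijective. Its sub-adjacent dynamical group is $K$ with structure map $\phi_K$ and products $a\circ_\lambda b=a\cdot_\lambda(a\vartriangleright_\lambda b)$. *)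

theory Defs
  imports "HOL-Algebra.Congruence"
begin

text \<open>
  The fixed non-empty parameter set is the explicit argument \<open>L\<close>, so it is shared by all the
  structures below. \<open>dact X l a\<close> is the structure map of \<open>X\<close> applied to \<open>(l, a)\<close>, and \<open>dmult X l a b\<close>
  is the product of \<open>a\<close> and \<open>b\<close> with index \<open>l\<close>. Values outside \<open>L\<close> and \<open>carrier X\<close> are irrelevant.
\<close>

record ('a, 'l) dyn_set = "'a partial_object" +
  dact :: "'l \<Rightarrow> 'a \<Rightarrow> 'l"

record ('a, 'l) dyn_magma = "('a, 'l) dyn_set" +
  dmult :: "'l \<Rightarrow> 'a \<Rightarrow> 'a \<Rightarrow> 'a"

record ('a, 'l) dyn_post = "('a, 'l) dyn_magma" +
  dtri :: "'l \<Rightarrow> 'a \<Rightarrow> 'a \<Rightarrow> 'a"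

locale dynamical_set =
  fixes L :: "'l set" and X :: "('a, 'l, 'm) dyn_set_scheme"
  assumes params_nonempty: "L \<noteq> {}"
    and dact_closed: "\<lbrakk>l \<in> L; a \<in> carrier X\<rbrakk> \<Longrightarrow> dact X l a \<in> L"

locale dynamical_group = dynamical_set L G
  for L :: "'l set" and G :: "('a, 'l, 'm) dyn_magma_scheme" +
  assumes dmult_closed: "\<lbrakk>l \<in> L; a \<in> carrier G; b \<in> carrier G\<rbrakk> \<Longrightarrow> dmult G l a b \<in> carrier G"
    and dact_dmult: "\<lbrakk>l \<in> L; a \<in> carrier G; b \<in> carrier G\<rbrakk> \<Longrightarrow>
      dact G l (dmult G l a b) = dact G (dact G l a) b"
    and dmult_assoc: "\<lbrakk>l \<in> L; a \<in> carrier G; b \<in> carrier G; c \<in> carrier G\<rbrakk> \<Longrightarrow>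
      dmult G l a (dmult G (dact G l a) b c) = dmult G l (dmult G l a b) c"
    and unit_inv: "\<exists>e\<in>carrier G.
      (\<forall>l\<in>L. dact G l e = l) \<and>
      (\<forall>l\<in>L. \<forall>a\<in>carrier G. dmult G l a e = a \<and> dmult G l e a = a) \<and>
      (\<forall>l\<in>L. \<forall>a\<in>carrier G. \<exists>a'\<in>carrier G.
         dmult G l a a' = e \<and> dmult G (dact G l a) a' a = e)"

locale constant_dynamical_group = dynamical_group L H
  for L :: "'l set" and H :: "('a, 'l, 'm) dyn_magma_scheme" +
  assumes dact_const: "\<lbrakk>l \<in> L; x \<in> carrier H\<rbrakk> \<Longrightarrow> dact H l x = l"

locale dynamical_group_action =
  G: dynamical_group L G + H: constant_dynamical_group L H
  for L :: "'l set"
    and G :: "('g, 'l, 'm) dyn_magma_scheme"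
    and H :: "('h, 'l, 'n) dyn_magma_scheme" +
  fixes \<Phi> :: "'l \<Rightarrow> 'g \<Rightarrow> 'h \<Rightarrow> 'h"
  assumes bij: "\<lbrakk>l \<in> L; a \<in> carrier G\<rbrakk> \<Longrightarrow> bij_betw (\<Phi> l a) (carrier H) (carrier H)"
    and distrib: "\<lbrakk>l \<in> L; a \<in> carrier G; x \<in> carrier H; y \<in> carrier H\<rbrakk> \<Longrightarrow>
      \<Phi> l a (dmult H (dact G l a) x y) = dmult H l (\<Phi> l a x) (\<Phi> l a y)"
    and comp: "\<lbrakk>l \<in> L; a \<in> carrier G; b \<in> carrier G; x \<in> carrier H\<rbrakk> \<Longrightarrow>
      \<Phi> l (dmult G l a b) x = \<Phi> l a (\<Phi> (dact G l a) b x)"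

locale relative_rota_baxter = dynamical_group_action L G H \<Phi>
  for L :: "'l set"
    and G :: "('g, 'l, 'm) dyn_magma_scheme"
    and H :: "('h, 'l, 'n) dyn_magma_scheme"
    and \<Phi> :: "'l \<Rightarrow> 'g \<Rightarrow> 'h \<Rightarrow> 'h" +
  fixes B :: "'h \<Rightarrow> 'g"
  assumes B_closed: "x \<in> carrier H \<Longrightarrow> B x \<in> carrier G"
    and rota_baxter: "\<lbrakk>l \<in> L; x \<in> carrier H; y \<in> carrier H\<rbrakk> \<Longrightarrow>
      dmult G l (B x) (B y) = B (dmult H l x (\<Phi> l (B x) y))"

definition descendant ::
  "('g, 'l, 'm) dyn_magma_scheme \<Rightarrow> ('h, 'l, 'n) dyn_magma_scheme \<Rightarrow>
   ('l \<Rightarrow> 'g \<Rightarrow> 'h \<Rightarrow> 'h) \<Rightarrow> ('h \<Rightarrow> 'g) \<Rightarrow> ('h, 'l) dyn_magma" where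
  "descendant G H \<Phi> B =
    \<lparr>carrier = carrier H,
     dact = (\<lambda>l x. dact G l (B x)),
     dmult = (\<lambda>l x y. dmult H l x (\<Phi> l (B x) y))\<rparr>"

text \<open>
  The products of a post-group form a constant dynamical group for the trivial structure map,
  whereas the compatibilities with \<open>dtri\<close> use the structure map \<open>dact K\<close> of the post-group itself.
\<close>

locale dynamical_post_group = dynamical_set L K
  for L :: "'l set" and K :: "('a, 'l, 'm) dyn_post_scheme" +
  assumes const_group: "constant_dynamical_group L
      \<lparr>carrier = carrier K, dact = (\<lambda>l a. l), dmult = dmult K\<rparr>"
    and dtri_bij: "\<lbrakk>l \<in> L; a \<in> carrier K\<rbrakk> \<Longrightarrow> bij_betw (dtri K l a) (carrier K) (carrier K)"
    and dtri_dmult: "\<lbrakk>l \<in> L; a \<in> carrier K; b \<in> carrier K; c \<in> carrier K\<rbrakk> \<Longrightarrow>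
      dtri K l a (dmult K (dact K l a) b c) = dmult K l (dtri K l a b) (dtri K l a c)"
    and dtri_dtri: "\<lbrakk>l \<in> L; a \<in> carrier K; b \<in> carrier K; c \<in> carrier K\<rbrakk> \<Longrightarrow>
      dtri K l (dmult K l a (dtri K l a b)) c = dtri K l a (dtri K (dact K l a) b c)"

definition sub_adjacent :: "('a, 'l, 'm) dyn_post_scheme \<Rightarrow> ('a, 'l) dyn_magma" where
  "sub_adjacent K =
    \<lparr>carrier = carrier K,
     dact = dact K,
     dmult = (\<lambda>l a b. dmult K l a (dtri K l a b))\<rparr>"

end

theory Submission
  imports Defs
begin

text \<open>
  The compatibility axioms transport along \<open>B\<close> by the Rota--Baxter identity. The unit of \<open>H\<close> is
  mapped to an idempotent of \<open>G\<close>, hence to the unit of \<open>G\<close>, so it is also a unit for the descendant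
  products. A right inverse of \<open>x\<close> at \<open>l\<close> is the preimage under \<open>\<Phi> l (B x)\<close> of the
  inverse of \<open>x\<close> in \<open>H\<close>; right inverses are two-sided because a right inverse of a right inverse
  of \<open>x\<close> is \<open>x\<close> itself.
\<close>

context dynamical_group
begin

text \<open>The inverse clause stands under the choice as well, so that the chosen element comes
  with inverses at every index.\<close>

definition unit :: 'a where
  "unit = (SOME e. e \<in> carrier G \<and>
      (\<forall>l\<in>L. dact G l e = l) \<and>
      (\<forall>l\<in>L. \<forall>a\<in>carrier G. dmult G l a e = a \<and> dmult G l e a = a) \<and>
      (\<forall>l\<in>L. \<forall>a\<in>carrier G. \<exists>a'\<in>carrier G.
         dmult G l a a' = e \<and> dmult G (dact G l a) a' a = e))"

lemma unit_spec:
  "unit \<in> carrier G \<and>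
      (\<forall>l\<in>L. dact G l unit = l) \<and>
      (\<forall>l\<in>L. \<forall>a\<in>carrier G. dmult G l a unit = a \<and> dmult G l unit a = a) \<and>
      (\<forall>l\<in>L. \<forall>a\<in>carrier G. \<exists>a'\<in>carrier G.
         dmult G l a a' = unit \<and> dmult G (dact G l a) a' a = unit)"
  unfolding unit_def by (rule someI_ex) (use unit_inv in blast)

lemma unit_closed: "unit \<in> carrier G"
  and dact_unit: "l \<in> L \<Longrightarrow> dact G l unit = l"
  and dmult_unit_right: "\<lbrakk>l \<in> L; a \<in> carrier G\<rbrakk> \<Longrightarrow> dmult G l a unit = a"
  and dmult_unit_left: "\<lbrakk>l \<in> L; a \<in> carrier G\<rbrakk> \<Longrightarrow> dmult G l unit a = a"
  using unit_spec by blast+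

lemma inverseE:
  assumes "l \<in> L" "a \<in> carrier G"
  obtains a' where "a' \<in> carrier G" "dmult G l a a' = unit" "dmult G (dact G l a) a' a = unit"
  using unit_spec assms by blast

text \<open>Cancel one factor with the inverse of \<open>a\<close>. Idempotency at a single index
  suffices, since all indices share the unit. This is the tool for showing that maps preserve
  units.\<close>

lemma idempotent_eq_unit:
  assumes l: "l \<in> L" and a: "a \<in> carrier G" and idem: "dmult G l a a = a"
  shows "a = unit"
proof -
  let ?m = "dact G l a"
  obtain a' where a': "a' \<in> carrier G" "dmult G l a a' = unit" "dmult G ?m a' a = unit"
    using l a by (rule inverseE)
  have m: "?m \<in> L"
    using l a by (rule dact_closed)
  \<comment> \<open>The inverse leads back from \<open>?m\<close> to \<open>l\<close>, so
    associativity at \<open>?m\<close> has its inner product at \<open>l\<close>, where idempotency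
    is given.\<close>
  have "dact G ?m a' = l"
    using dact_dmult[OF l a a'(1)] a'(2) dact_unit[OF l] by simp
  then have "dmult G ?m a' (dmult G l a a) = dmult G ?m (dmult G ?m a' a) a"
    using dmult_assoc[OF m a'(1) a a] by simp
  then show ?thesis
    using idem a' dmult_unit_left[OF m a] by simp
qed

end

context dynamical_group_action
begin

text \<open>The unit is idempotent and fixes \<open>l\<close>, so its action is an idempotent map.
  It is also injective, hence the identity on \<open>carrier H\<close>.\<close>

lemma action_unit:
  assumes l: "l \<in> L" and x: "x \<in> carrier H"
  shows "\<Phi> l G.unit x = x"
proof -
  note b = bij[OF l G.unit_closed]
  have "\<Phi> l G.unit (\<Phi> l G.unit x) = \<Phi> l G.unit x"
    using comp[OF l G.unit_closed G.unit_closed x] G.dact_unit[OF l]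
      G.dmult_unit_left[OF l G.unit_closed] by simp
  then show ?thesis
    using inj_onD[OF bij_betw_imp_inj_on[OF b]] x bij_betwE[OF b] by blast
qed

lemma action_closed:
  "\<lbrakk>l \<in> L; a \<in> carrier G; x \<in> carrier H\<rbrakk> \<Longrightarrow> \<Phi> l a x \<in> carrier H"
  using bij bij_betwE by blast

text \<open>Distributivity applied to the square of the unit at index \<open>dact G l a\<close>
  makes its image idempotent at \<open>l\<close>.\<close>

lemma action_on_unit:
  assumes l: "l \<in> L" and a: "a \<in> carrier G"
  shows "\<Phi> l a H.unit = H.unit"
proof (rule H.idempotent_eq_unit[OF l])
  show "\<Phi> l a H.unit \<in> carrier H"
    using l a H.unit_closed by (rule action_closed)
  show "dmult H l (\<Phi> l a H.unit) (\<Phi> l a H.unit) = \<Phi> l a H.unit"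
    using distrib[OF l a H.unit_closed H.unit_closed]
      H.dmult_unit_left[OF G.dact_closed[OF l a] H.unit_closed] by simp
qed

end

context relative_rota_baxter
begin

abbreviation desc_mult :: "'l \<Rightarrow> 'h \<Rightarrow> 'h \<Rightarrow> 'h" where
  "desc_mult l x y \<equiv> dmult H l x (\<Phi> l (B x) y)"

abbreviation desc_act :: "'l \<Rightarrow> 'h \<Rightarrow> 'l" where
  "desc_act l x \<equiv> dact G l (B x)"

text \<open>The action fixes \<open>H.unit\<close>, so the Rota-Baxter identity at this element
  makes its image idempotent. Any one index will do, and \<open>L\<close> being non-empty provides
  it.\<close>

lemma B_unit: "B H.unit = G.unit"
proof -
  obtain l where l: "l \<in> L"
    using G.params_nonempty by blast
  have BU: "B H.unit \<in> carrier G"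
    using H.unit_closed by (rule B_closed)
  show ?thesis
    using rota_baxter[OF l H.unit_closed H.unit_closed] action_on_unit[OF l BU]
      H.dmult_unit_left[OF l H.unit_closed]
    by (intro G.idempotent_eq_unit[OF l BU]) simp
qed

lemma desc_act_closed: "\<lbrakk>l \<in> L; x \<in> carrier H\<rbrakk> \<Longrightarrow> desc_act l x \<in> L"
  using B_closed G.dact_closed by blast

lemma desc_mult_closed:
  "\<lbrakk>l \<in> L; x \<in> carrier H; y \<in> carrier H\<rbrakk> \<Longrightarrow> desc_mult l x y \<in> carrier H"
  by (simp add: B_closed H.dmult_closed action_closed)

lemma desc_act_mult:
  "\<lbrakk>l \<in> L; x \<in> carrier H; y \<in> carrier H\<rbrakk> \<Longrightarrow>
    desc_act l (desc_mult l x y) = desc_act (desc_act l x) y"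
  using G.dact_dmult[of l "B x" "B y"] by (simp add: rota_baxter B_closed)

text \<open>\<open>B\<close> turns descendant products into products of \<open>G\<close>, which the
  action turns into compositions. This is the post-group axiom \<open>dtri_dtri\<close>, and it also
  drives associativity below.\<close>

lemma action_desc_mult:
  "\<lbrakk>l \<in> L; x \<in> carrier H; y \<in> carrier H; z \<in> carrier H\<rbrakk> \<Longrightarrow>
    \<Phi> l (B (desc_mult l x y)) z = \<Phi> l (B x) (\<Phi> (desc_act l x) (B y) z)"
  using comp[of l "B x" "B y" z] by (simp add: rota_baxter B_closed)

text \<open>Distributivity pulls the product at \<open>?m\<close> back to one at \<open>l\<close>.
  As \<open>H\<close> is constant, its own associativity then stays at \<open>l\<close>, and
  \<open>action_desc_mult\<close> identifies the last factor.\<close>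

lemma desc_mult_assoc:
  assumes l: "l \<in> L" and x: "x \<in> carrier H" and y: "y \<in> carrier H" and z: "z \<in> carrier H"
  shows "desc_mult l x (desc_mult (desc_act l x) y z) = desc_mult l (desc_mult l x y) z"
proof -
  let ?m = "desc_act l x"
  have m: "?m \<in> L"
    using l x by (rule desc_act_closed)
  have cl: "\<Phi> ?m (B y) z \<in> carrier H" "\<Phi> l (B x) y \<in> carrier H"
    using m l x y z by (simp_all add: B_closed action_closed)
  then have cl': "\<Phi> l (B x) (\<Phi> ?m (B y) z) \<in> carrier H"
    using l x by (simp add: B_closed action_closed)
  show ?thesis
    using distrib[OF l B_closed[OF x] y cl(1)] H.dmult_assoc[OF l x cl(2) cl']
      H.dact_const[OF l x] action_desc_mult[OF l x y z]
    by simp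
qed

lemma desc_mult_unit_left: "\<lbrakk>l \<in> L; x \<in> carrier H\<rbrakk> \<Longrightarrow> desc_mult l H.unit x = x"
  by (simp add: B_unit action_unit H.dmult_unit_left)

lemma desc_mult_unit_right: "\<lbrakk>l \<in> L; x \<in> carrier H\<rbrakk> \<Longrightarrow> desc_mult l x H.unit = x"
  by (simp add: B_closed action_on_unit H.dmult_unit_right)

lemma desc_right_inverseE:
  assumes l: "l \<in> L" and x: "x \<in> carrier H"
  obtains x' where "x' \<in> carrier H" "desc_mult l x x' = H.unit"
proof -
  obtain y where y: "y \<in> carrier H" "dmult H l x y = H.unit"
    using l x by (rule H.inverseE)
  have "y \<in> \<Phi> l (B x) ` carrier H"
    using bij_betw_imp_surj_on[OF bij[OF l B_closed[OF x]]] y(1) by simp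
  then obtain x' where x': "x' \<in> carrier H" "\<Phi> l (B x) x' = y"
    by (auto elim: imageE)
  show ?thesis
    using that[OF x'(1)] x'(2) y(2) by simp
qed

lemma desc_inverse:
  assumes l: "l \<in> L" and x: "x \<in> carrier H"
  shows "\<exists>x'\<in>carrier H. desc_mult l x x' = H.unit \<and> desc_mult (desc_act l x) x' x = H.unit"
proof -
  have m: "desc_act l x \<in> L"
    using l x by (rule desc_act_closed)
  obtain x' where x': "x' \<in> carrier H" "desc_mult l x x' = H.unit"
    using l x by (rule desc_right_inverseE)
  \<comment> \<open>Associativity at \<open>l\<close> wants its inner product at this index, which
    is also the index of the left inverse equation to be proved.\<close>
  obtain x'' where x'': "x'' \<in> carrier H" "desc_mult (desc_act l x) x' x'' = H.unit"
    using m x'(1) by (rule desc_right_inverseE)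
  have "x'' = desc_mult l (desc_mult l x x') x''"
    using desc_mult_unit_left[OF l x''(1)] x'(2) by simp
  also have "\<dots> = desc_mult l x (desc_mult (desc_act l x) x' x'')"
    using desc_mult_assoc[OF l x x'(1) x''(1)] by simp
  also have "\<dots> = x"
    using desc_mult_unit_right[OF l x] x''(2) by simp
  finally have "x'' = x" .
  then show ?thesis
    using x' x''(2) by (intro bexI[of _ x']) simp_all
qed

lemma dynamical_group_descendant: "dynamical_group L (descendant G H \<Phi> B)"
proof
  show "\<exists>e\<in>carrier (descendant G H \<Phi> B).
      (\<forall>l\<in>L. dact (descendant G H \<Phi> B) l e = l) \<and>
      (\<forall>l\<in>L. \<forall>a\<in>carrier (descendant G H \<Phi> B).
         dmult (descendant G H \<Phi> B) l a e = a \<and> dmult (descendant G H \<Phi> B) l e a = a) \<and>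
      (\<forall>l\<in>L. \<forall>a\<in>carrier (descendant G H \<Phi> B). \<exists>a'\<in>carrier (descendant G H \<Phi> B).
         dmult (descendant G H \<Phi> B) l a a' = e \<and>
         dmult (descendant G H \<Phi> B) (dact (descendant G H \<Phi> B) l a) a' a = e)"
    by (rule bexI[of _ H.unit])
      (simp_all add: descendant_def H.unit_closed B_unit G.dact_unit action_unit
        H.dmult_unit_left desc_mult_unit_right desc_inverse)
qed (simp_all add: descendant_def G.params_nonempty desc_act_closed desc_mult_closed
    desc_act_mult desc_mult_assoc)

lemma dynamical_post_group_rota_baxter:
  "dynamical_post_group L
    \<lparr>carrier = carrier H, dact = \<lambda>l x. dact G l (B x), dmult = dmult H,
     dtri = \<lambda>l x y. \<Phi> l (B x) y\<rparr>"
proof (intro dynamical_post_group.intro dynamical_post_group_axioms.intro dynamical_set.intro)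
  \<comment> \<open>\<open>dact H\<close> is the trivial structure map only on \<open>L\<close> and
    \<open>carrier H\<close>, so the group axioms of \<open>H\<close> are first restated with
    \<open>l\<close> in place of \<open>dact H l a\<close>.\<close>
  have "\<exists>a'\<in>carrier H. dmult H l a a' = H.unit \<and> dmult H l a' a = H.unit"
    if la: "l \<in> L" "a \<in> carrier H" for l a
  proof -
    obtain a' where "a' \<in> carrier H" "dmult H l a a' = H.unit" "dmult H (dact H l a) a' a = H.unit"
      using la by (rule H.inverseE)
    then show ?thesis
      using H.dact_const[OF la] by auto
  qed
  then have "\<exists>e\<in>carrier H.
      (\<forall>l\<in>L. \<forall>a\<in>carrier H. dmult H l a e = a \<and> dmult H l e a = a) \<and>
      (\<forall>l\<in>L. \<forall>a\<in>carrier H. \<exists>a'\<in>carrier H. dmult H l a a' = e \<and> dmult H l a' a = e)"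
    by (intro bexI[of _ H.unit])
      (simp_all add: H.unit_closed H.dmult_unit_left H.dmult_unit_right)
  moreover have "dmult H l a (dmult H l b c) = dmult H l (dmult H l a b) c"
    if "l \<in> L" "a \<in> carrier H" "b \<in> carrier H" "c \<in> carrier H" for l a b c
    using H.dmult_assoc[OF that] H.dact_const[OF that(1,2)] by simp
  ultimately show "constant_dynamical_group L
      \<lparr>carrier = carrier \<lparr>carrier = carrier H, dact = \<lambda>l x. dact G l (B x), dmult = dmult H,
         dtri = \<lambda>l x y. \<Phi> l (B x) y\<rparr>,
       dact = \<lambda>l a. l,
       dmult = dmult \<lparr>carrier = carrier H, dact = \<lambda>l x. dact G l (B x), dmult = dmult H,
         dtri = \<lambda>l x y. \<Phi> l (B x) y\<rparr>\<rparr>"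
    by unfold_locales (simp_all add: G.params_nonempty H.dmult_closed)
qed (simp_all add: G.params_nonempty desc_act_closed bij B_closed distrib action_desc_mult)

end

theorem proposition4p9:
  fixes L :: "'l set"
    and G :: "('g, 'l, 'm) dyn_magma_scheme"
    and H :: "('h, 'l, 'n) dyn_magma_scheme"
    and \<Phi> :: "'l \<Rightarrow> 'g \<Rightarrow> 'h \<Rightarrow> 'h"
    and B :: "'h \<Rightarrow> 'g"
    and \<phi>\<^sub>B :: "'l \<Rightarrow> 'h \<Rightarrow> 'l"
    and tri\<^sub>B :: "'l \<Rightarrow> 'h \<Rightarrow> 'h \<Rightarrow> 'h"
    and K :: "('h, 'l) dyn_post"
  assumes "dynamical_group L G"
    and "constant_dynamical_group L H"
    and "dynamical_group_action L G H \<Phi>"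
    and "relative_rota_baxter L G H \<Phi> B"
  defines "\<phi>\<^sub>B \<equiv> \<lambda>l x. dact G l (B x)"
    and "tri\<^sub>B \<equiv> \<lambda>l x y. \<Phi> l (B x) y"
    and "K \<equiv> \<lparr>carrier = carrier H, dact = \<phi>\<^sub>B, dmult = dmult H, dtri = tri\<^sub>B\<rparr>"
  shows "dynamical_post_group L K \<and>
    dynamical_group L (sub_adjacent K) \<and>
    sub_adjacent K = descendant G H \<Phi> B"
proof -
  interpret relative_rota_baxter L G H \<Phi> B
    by fact
  \<comment> \<open>Both sides unfold to the same record, so \<open>sub_adjacent K\<close> inherits
    the group axioms proved for the descendant.\<close>
  have "sub_adjacent K = descendant G H \<Phi> B"
    by (simp add: sub_adjacent_def descendant_def K_def \<phi>\<^sub>B_def tri\<^sub>B_def)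
  then show ?thesis
    using dynamical_post_group_rota_baxter dynamical_group_descendant
    by (simp add: K_def \<phi>\<^sub>B_def tri\<^sub>B_def)
qed

end
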